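(* Let $\mathcal P^{\mathrm{multi}}_{X\vert Y}$ and $\mathcal P^{\mathrm{single}}_{X\vert Y}$ be the multi-source and single-source conditional distribution spaces built from a parametric family $p_{\phi,\psi}(\boldsymbol x\vert k)$, $\phi\in\Phi$, $\psi\in\Psi$, $k\in\{1,\dots,K\}$, i.e. $$\mathcal P^{\mathrm{multi}}_{X\vert Y}=\Big\{\textstyle\prod_{k=1}^K (p_{\phi_k,\psi}(\boldsymbol x\vert k))^{\mathbb I(y=k)}:\phi_1,\dots,\phi_K\in\Phi,\ \psi\in\Psi\Big\},$$ $$\mathcal P^{\mathrm{single}}_{X\vert Y}=\Big\{\textstyle\prod_{k=1}^K (p_{\phi_k,\psi_k}(\boldsymbol x\vert k))^{\mathbb I(y=k)}:\phi_1,\dots,\phi_K\in\Phi,\ \psi_1,\dots,\psi_K\in\Psi\Big\}.$$ Then for any $\epsilon>0$ and $1\le\mathsf p\le\infty$, $$\mathcal N_{[]}\big(\epsilon;\mathcal P^{\mathrm{multi}}_{X\vert Y},L^{\mathsf p}(\mathscr X)\big)\le \mathcal N_{[]}\big(\epsilon;\mathcal P^{\mathrm{single}}_{X\vert Y},L^{\mathsf p}(\mathscr X)\big).$$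
   Context: $\mathscr X$ is the data space, $\mathscr Y=\{1,\dots,K\}$ the label space, $\Phi$ and $\Psi$ are parameter spaces, and for each $k\in\{1,\dots,K\}$, $\phi\in\Phi$, $\psi\in\Psi$, $p_{\phi,\psi}(\cdot\vert k)$ is a probability density (or mass) function on $\mathscr X$. $\mathbb I$ is the indicator function. Upper bracketing number: for $\epsilon>0$ and $1\le \mathsf p\le\infty$, an $\epsilon$-upper bracket of a conditional distribution space $\mathcal P_{X\vert Y}$ with respect to $L^{\mathsf p}(\mathscr X)$ is a finite set $\mathcal B$ of functions on $\mathscr X\times\mathscr Y$ such that for any $p_{X\vert Y}\in\mathcal P_{X\vert Y}$ there is $p'\in\mathcal B$ such that for every $y\in\mathscr Y$: $p'(\boldsymbol x,y)\ge p_{X\vert Y}(\boldsymbol x\vert y)$ for all $\boldsymbol x\in\mathscr X$, and $\|p'(\cdot,y)-p_{X\vert Y}(\cdot\vert y)\|_{L^{\mathsf p}(\mathscr X)}\le\epsilon$. The $\epsilon$-upper bracketing number $\mathcal N_{[]}(\epsilon;\mathcal P_{X\vert Y},L^{\mathsf p}(\mathscr X))$ is the cardinality of the smallest $\epsilon$-upper bracket (infinite if none exists). *)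

theory Defs
  imports "HOL-Probability.Probability" "HOL-Library.Extended_Nat"
begin

text \<open>
  The data space is \<open>space M\<close>, where the measure \<open>M\<close> is the reference measure with respect to which
  densities and \<open>L\<^sup>p\<close> norms are taken (counting measure gives mass functions). The label space
  is \<open>{1..K}\<close>.
\<close>

definition prob_density :: "'x measure \<Rightarrow> ('x \<Rightarrow> real) \<Rightarrow> bool" where
  "prob_density M f \<longleftrightarrow>
     f \<in> borel_measurable M \<and> (\<forall>x\<in>space M. 0 \<le> f x) \<and> (\<integral>\<^sup>+ x. ennreal (f x) \<partial>M) = 1"

text \<open>
  The \<open>L\<^sup>p\<close> norm for an exponent \<open>p \<in> [1, \<infinity>]\<close>, with value \<open>\<infinity>\<close> for a measurable function outside
  \<open>L\<^sup>p\<close>. It is meaningful for measurable functions only. The library has no \<open>powr\<close> on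
  \<^typ>\<open>ennreal\<close>, so the root of an infinite integral is a separate case.
\<close>

definition Lp_norm :: "'x measure \<Rightarrow> ennreal \<Rightarrow> ('x \<Rightarrow> real) \<Rightarrow> ennreal" where
  "Lp_norm M p f =
     (if p = \<infinity> then esssup M (\<lambda>x. ennreal \<bar>f x\<bar>)
      else let I = (\<integral>\<^sup>+ x. ennreal (\<bar>f x\<bar> powr enn2real p) \<partial>M)
           in if I = \<infinity> then \<infinity> else ennreal (enn2real I powr (1 / enn2real p)))"

text \<open>
  A conditional distribution is a function \<open>f\<close> with \<open>f x y\<close> standing for the density of \<open>x\<close> given
  the label \<open>y\<close>; only its values on \<open>space M \<times> {1..K}\<close> matter. The measurability clause is what
  membership of the difference in \<open>L\<^sup>p\<close> requires in addition to a finite norm.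
  Bracket elements are total functions; restricting them to \<open>space M \<times> {1..K}\<close> keeps a bracket a
  bracket and cannot increase its cardinality, so values elsewhere do not affect the bracketing
  number.
\<close>

definition upper_bracket ::
    "'x measure \<Rightarrow> nat \<Rightarrow> ennreal \<Rightarrow> real \<Rightarrow> ('x \<Rightarrow> nat \<Rightarrow> real) set \<Rightarrow> ('x \<Rightarrow> nat \<Rightarrow> real) set \<Rightarrow> bool"
  where
  "upper_bracket M K p \<epsilon> \<P> B \<longleftrightarrow>
     finite B \<and>
     (\<forall>f\<in>\<P>. \<exists>g\<in>B. \<forall>y\<in>{1..K}.
        (\<forall>x\<in>space M. f x y \<le> g x y) \<and>
        (\<lambda>x. g x y - f x y) \<in> borel_measurable M \<and>
        Lp_norm M p (\<lambda>x. g x y - f x y) \<le> ennreal \<epsilon>)"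

text \<open>The infimum of the empty set in \<^typ>\<open>enat\<close> is \<open>\<infinity>\<close>.\<close>

definition upper_bracketing_number ::
    "'x measure \<Rightarrow> nat \<Rightarrow> ennreal \<Rightarrow> real \<Rightarrow> ('x \<Rightarrow> nat \<Rightarrow> real) set \<Rightarrow> enat" where
  "upper_bracketing_number M K p \<epsilon> \<P> = (INF B\<in>{B. upper_bracket M K p \<epsilon> \<P> B}. enat (card B))"

text \<open>
  \<open>dens \<phi> \<psi> k x\<close> is the density of the parametric family at \<open>x\<close> given the label \<open>k\<close>. The exponent
  is a natural number, so \<open>0 ^ 0 = 1\<close>, as the product notation intends.
\<close>

definition multi_source ::
    "nat \<Rightarrow> 'phi set \<Rightarrow> 'psi set \<Rightarrow> ('phi \<Rightarrow> 'psi \<Rightarrow> nat \<Rightarrow> 'x \<Rightarrow> real) \<Rightarrow> ('x \<Rightarrow> nat \<Rightarrow> real) set" where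
  "multi_source K \<Phi> \<Psi> dens =
     {\<lambda>x y. \<Prod>k=1..K. dens (\<phi> k) \<psi> k x ^ (of_bool (y = k) :: nat) | \<phi> \<psi>.
        (\<forall>k\<in>{1..K}. \<phi> k \<in> \<Phi>) \<and> \<psi> \<in> \<Psi>}"

definition single_source ::
    "nat \<Rightarrow> 'phi set \<Rightarrow> 'psi set \<Rightarrow> ('phi \<Rightarrow> 'psi \<Rightarrow> nat \<Rightarrow> 'x \<Rightarrow> real) \<Rightarrow> ('x \<Rightarrow> nat \<Rightarrow> real) set" where
  "single_source K \<Phi> \<Psi> dens =
     {\<lambda>x y. \<Prod>k=1..K. dens (\<phi> k) (\<psi> k) k x ^ (of_bool (y = k) :: nat) | \<phi> \<psi>.
        (\<forall>k\<in>{1..K}. \<phi> k \<in> \<Phi>) \<and> (\<forall>k\<in>{1..K}. \<psi> k \<in> \<Psi>)}"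

end

theory Submission
  imports Defs
begin

text \<open>Sharing one parameter \<psi> across all labels is a special case of choosing one per
  label, so the multi-source space lies inside the single-source space
  (\<open>multi_source_subset_single_source\<close>). Whatever brackets a space also brackets its
  subsets, so bracketing numbers are monotone under inclusion
  (\<open>upper_bracketing_number_mono\<close>).\<close>

lemma multi_source_subset_single_source:
  "multi_source K \<Phi> \<Psi> dens \<subseteq> single_source K \<Phi> \<Psi> dens"
proof
  fix f assume "f \<in> multi_source K \<Phi> \<Psi> dens"
  then obtain \<phi> \<psi> where
    "f = (\<lambda>x y. \<Prod>k=1..K. dens (\<phi> k) \<psi> k x ^ (of_bool (y = k) :: nat))"
    "\<forall>k\<in>{1..K}. \<phi> k \<in> \<Phi>" "\<psi> \<in> \<Psi>"
    unfolding multi_source_def by blast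
  then show "f \<in> single_source K \<Phi> \<Psi> dens"
    \<comment> \<open>The constant family assigns the shared \<open>\<psi>\<close> to every label,
      which makes the two products identical.\<close>
    unfolding single_source_def by (intro CollectI exI[of _ \<phi>] exI[of _ "\<lambda>_. \<psi>"]) simp
qed

text \<open>Bracket elements need not belong to the space they bracket, so the same \<open>B\<close>
  serves the smaller space unchanged.\<close>

lemma upper_bracket_subset:
  "upper_bracket M K p \<epsilon> Q B \<Longrightarrow> P \<subseteq> Q \<Longrightarrow> upper_bracket M K p \<epsilon> P B"
  unfolding upper_bracket_def by blast

text \<open>The smaller space admits at least as many brackets, and an infimum over a larger
  collection is no larger. If \<open>Q\<close> has no bracket, the right-hand side is
  \<infinity>.\<close>

lemma upper_bracketing_number_mono:
  "P \<subseteq> Q \<Longrightarrow> upper_bracketing_number M K p \<epsilon> P \<le> upper_bracketing_number M K p \<epsilon> Q"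
  unfolding upper_bracketing_number_def
  by (intro INF_superset_mono) (auto intro: upper_bracket_subset)

theorem proposition3p3:
  fixes M :: "'x measure" and K :: nat
    and \<Phi> :: "'phi set" and \<Psi> :: "'psi set"
    and dens :: "'phi \<Rightarrow> 'psi \<Rightarrow> nat \<Rightarrow> 'x \<Rightarrow> real"
    and p :: ennreal and \<epsilon> :: real
  assumes dens: "\<And>\<phi> \<psi> k. \<phi> \<in> \<Phi> \<Longrightarrow> \<psi> \<in> \<Psi> \<Longrightarrow> k \<in> {1..K} \<Longrightarrow> prob_density M (dens \<phi> \<psi> k)"
    and eps: "\<epsilon> > 0"
    and p: "1 \<le> p"
  shows "upper_bracketing_number M K p \<epsilon> (multi_source K \<Phi> \<Psi> dens)
           \<le> upper_bracketing_number M K p \<epsilon> (single_source K \<Phi> \<Psi> dens)"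
  by (intro upper_bracketing_number_mono multi_source_subset_single_source)

end
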